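(* Let $a,b,c\in\mathbb{Z}$. Then there exists $h\in\mathbb{Z}$ such that either $\mathcal{R}_H(a,b,c)=\mathcal{R}_H(0,0,0)+h$, or $\mathcal{R}_H(a,b,c)=\mathcal{R}_H(0,1,1)+h=\mathcal{R}_H(1,0,1)+h=\mathcal{R}_H(1,1,0)+h$.
   Context: Define $H'(x,y,z)=(-x+1+y+z,\,y,\,z)$, $H''(x,y,z)=(x,\,-y+1+z+x,\,z)$, $H'''(x,y,z)=(x,\,y,\,-z+1+x+y)$ on $\mathbb{Z}^3$. $\mathcal{T}_H(a,b,c)$ is the set of all triples obtained from $(a,b,c)$ by applying any finite (possibly empty) sequence of $H',H'',H'''$; $\mathcal{R}_H(a,b,c)$ is the set of integers occurring as a component of some triple in $\mathcal{T}_H(a,b,c)$. For a set $\mathcal{S}\subseteq\mathbb{Z}$, $\mathcal{S}+h=\{s+h:s\in\mathcal{S}\}$. *)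

theory Defs
  imports Main
begin

definition H1 :: "int \<times> int \<times> int \<Rightarrow> int \<times> int \<times> int" where
  "H1 = (\<lambda>(x, y, z). (- x + 1 + y + z, y, z))"

definition H2 :: "int \<times> int \<times> int \<Rightarrow> int \<times> int \<times> int" where
  "H2 = (\<lambda>(x, y, z). (x, - y + 1 + z + x, z))"

definition H3 :: "int \<times> int \<times> int \<Rightarrow> int \<times> int \<times> int" where
  "H3 = (\<lambda>(x, y, z). (x, y, - z + 1 + x + y))"

inductive_set T_H :: "int \<times> int \<times> int \<Rightarrow> (int \<times> int \<times> int) set"
  for t :: "int \<times> int \<times> int" where
  start: "t \<in> T_H t"
| H1: "u \<in> T_H t \<Longrightarrow> H1 u \<in> T_H t"
| H2: "u \<in> T_H t \<Longrightarrow> H2 u \<in> T_H t"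
| H3: "u \<in> T_H t \<Longrightarrow> H3 u \<in> T_H t"

definition R_H :: "int \<times> int \<times> int \<Rightarrow> int set" where
  "R_H t = {n. \<exists>x y z. (x, y, z) \<in> T_H t \<and> (n = x \<or> n = y \<or> n = z)}"

definition shift :: "int set \<Rightarrow> int \<Rightarrow> int set" where
  "shift S h = {s + h | s. s \<in> S}"

end

theory Submission
  imports Defs
begin

text \<open>
  Each of the three maps is an involution, so the range of a triple depends only on its orbit.
  The form x^2 + y^2 + z^2 - xy - yz - zx is nonnegative, and replacing x by
  x' = 1 + y + z - x changes it by x' - x. Applying a map whenever it decreases a component
  therefore terminates, at a triple with 2x - y - z, 2y - z - x, 2z - x - y all at most 1.
  Since these three integers sum to 0 and their pairwise differences are multiples of 3,
  such a triple is a translate of (0,0,0) or of a rotation of (0,1,1). Translations and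
  rotations of coordinates permute the three maps.
\<close>

lemma H1_involution: "H1 (H1 u) = u"
  and H2_involution: "H2 (H2 u) = u"
  and H3_involution: "H3 (H3 u) = u"
  by (auto simp: H1_def H2_def H3_def split: prod.splits)

lemma T_H_trans:
  assumes "u \<in> T_H v" and "v \<in> T_H t"
  shows "u \<in> T_H t"
  using assms by (induction rule: T_H.induct) (auto intro: T_H.intros)

lemma T_H_sym:
  assumes "u \<in> T_H t"
  shows "t \<in> T_H u"
  using assms
proof (induction rule: T_H.induct)
  case start
  show ?case by (rule T_H.start)
next
  case (H1 u)
  \<comment> \<open>The orbit is started at \<open>H1 u\<close> instead of \<open>u\<close>: one
    more application of \<open>H1\<close> leads back to \<open>u\<close>.\<close>
  have "u \<in> T_H (H1 u)" using T_H.H1[OF T_H.start, of "H1 u"] by (simp add: H1_involution)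
  with H1.IH show ?case by (rule T_H_trans)
next
  case (H2 u)
  have "u \<in> T_H (H2 u)" using T_H.H2[OF T_H.start, of "H2 u"] by (simp add: H2_involution)
  with H2.IH show ?case by (rule T_H_trans)
next
  case (H3 u)
  have "u \<in> T_H (H3 u)" using T_H.H3[OF T_H.start, of "H3 u"] by (simp add: H3_involution)
  with H3.IH show ?case by (rule T_H_trans)
qed

lemma R_H_eq_if_mem_T_H:
  assumes "u \<in> T_H t"
  shows "R_H u = R_H t"
proof -
  have "T_H u = T_H t" using T_H_trans T_H_sym assms by blast
  then show ?thesis by (simp add: R_H_def)
qed

definition translate :: "int \<Rightarrow> int \<times> int \<times> int \<Rightarrow> int \<times> int \<times> int" where
  "translate h = (\<lambda>(x, y, z). (x + h, y + h, z + h))"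

lemma translate_H:
  "translate h (H1 u) = H1 (translate h u)"
  "translate h (H2 u) = H2 (translate h u)"
  "translate h (H3 u) = H3 (translate h u)"
  by (auto simp: translate_def H1_def H2_def H3_def split: prod.splits)

lemma translate_mem_T_H:
  assumes "u \<in> T_H t"
  shows "translate h u \<in> T_H (translate h t)"
  using assms by (induction rule: T_H.induct) (auto simp: translate_H intro: T_H.intros)

lemma shift_R_H_subset: "shift (R_H t) h \<subseteq> R_H (translate h t)"
  using translate_mem_T_H[of _ t h] by (fastforce simp: shift_def R_H_def translate_def)

lemma R_H_translate: "R_H (translate h t) = shift (R_H t) h"
proof
  \<comment> \<open>The reverse inclusion is the proved one applied to the inverse
    translation.\<close>
  have "translate (- h) (translate h t) = t"
    by (simp add: translate_def split: prod.splits)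
  then have "shift (R_H (translate h t)) (- h) \<subseteq> R_H t"
    using shift_R_H_subset[of "translate h t" "- h"] by simp
  then show "R_H (translate h t) \<subseteq> shift (R_H t) h"
    unfolding shift_def by (force simp: subset_iff)
qed (rule shift_R_H_subset)

definition rot :: "int \<times> int \<times> int \<Rightarrow> int \<times> int \<times> int" where
  "rot = (\<lambda>(x, y, z). (y, z, x))"

lemma rot_H:
  "rot (H1 u) = H3 (rot u)"
  "rot (H2 u) = H1 (rot u)"
  "rot (H3 u) = H2 (rot u)"
  by (auto simp: rot_def H1_def H2_def H3_def split: prod.splits)

lemma rot_mem_T_H:
  assumes "u \<in> T_H t"
  shows "rot u \<in> T_H (rot t)"
  using assms by (induction rule: T_H.induct) (auto simp: rot_H intro: T_H.intros)

lemma R_H_subset_rot: "R_H t \<subseteq> R_H (rot t)"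
  using rot_mem_T_H[of _ t] by (fastforce simp: R_H_def rot_def)

text \<open>Since \<open>rot\<close> has order three, the inclusions along its cycle close up to
  equalities.\<close>

lemma R_H_rot: "R_H (rot t) = R_H t"
proof
  have "rot (rot (rot t)) = t" by (simp add: rot_def split: prod.splits)
  then show "R_H (rot t) \<subseteq> R_H t"
    using R_H_subset_rot[of "rot t"] R_H_subset_rot[of "rot (rot t)"] by simp
qed (rule R_H_subset_rot)

definition spread :: "int \<times> int \<times> int \<Rightarrow> int" where
  "spread = (\<lambda>(x, y, z). x\<^sup>2 + y\<^sup>2 + z\<^sup>2 - x * y - y * z - z * x)"

lemma spread_nonneg: "0 \<le> spread t"
proof (cases t)
  case (fields x y z)
  have "2 * spread t = (x - y)\<^sup>2 + (y - z)\<^sup>2 + (z - x)\<^sup>2"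
    by (simp add: fields spread_def power2_eq_square algebra_simps)
  moreover have "\<dots> \<ge> 0" by simp
  ultimately show ?thesis by linarith
qed

text \<open>With x' the new first component, the form changes by (x' - x) * (x' + x - y - z), and
  the second factor is 1. The other two cases follow by symmetry.\<close>

lemma spread_H:
  "spread (H1 (x, y, z)) = spread (x, y, z) + (1 + y + z - 2 * x)"
  "spread (H2 (x, y, z)) = spread (x, y, z) + (1 + z + x - 2 * y)"
  "spread (H3 (x, y, z)) = spread (x, y, z) + (1 + x + y - 2 * z)"
  by (simp_all add: spread_def H1_def H2_def H3_def power2_eq_square algebra_simps)

lemma ex_reduced_mem_T_H:
  "\<exists>x y z. (x, y, z) \<in> T_H t \<and> 2 * x - y - z \<le> 1 \<and> 2 * y - z - x \<le> 1 \<and> 2 * z - x - y \<le> 1"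
proof (induction "nat (spread t)" arbitrary: t rule: less_induct)
  case less
  obtain x y z where t: "t = (x, y, z)" by (cases t)
  have step: ?case if "u \<in> T_H t" and "spread u < spread t" for u
  proof -
    have "nat (spread u) < nat (spread t)" using that(2) spread_nonneg[of u] by linarith
    from less[OF this] show ?thesis using T_H_trans[OF _ that(1)] by blast
  qed
  \<comment> \<open>The bound 1 is the exact threshold: by \<open>spread_H\<close>, a map lowers
    \<open>spread\<close> strictly iff its expression exceeds 1.\<close>
  consider "2 * x - y - z \<le> 1" "2 * y - z - x \<le> 1" "2 * z - x - y \<le> 1"
    | "2 * x - y - z > 1" | "2 * y - z - x > 1" | "2 * z - x - y > 1" by linarith
  then show ?case
  proof cases
    case 1
    then show ?thesis using T_H.start[of t] t by blast
  next
    case 2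
    then show ?thesis
      using step[OF T_H.H1[OF T_H.start]] by (simp add: t spread_H)
  next
    case 3
    then show ?thesis
      using step[OF T_H.H2[OF T_H.start]] by (simp add: t spread_H)
  next
    case 4
    then show ?thesis
      using step[OF T_H.H3[OF T_H.start]] by (simp add: t spread_H)
  qed
qed

text \<open>The three expressions sum to 0 and agree modulo 3. With residue 0 all are 0; with
  residue 1 they are 1, 1, -2 in some order; with residue 2 each is at most -1, which is
  impossible.\<close>

lemma reduced_cases:
  fixes x y z :: int
  assumes "2 * x - y - z \<le> 1" and "2 * y - z - x \<le> 1" and "2 * z - x - y \<le> 1"
  shows "\<exists>h. (x, y, z) \<in> translate h ` {(0, 0, 0), (0, 1, 1), (1, 0, 1), (1, 1, 0)}"
proof -
  \<comment> \<open>The disjuncts follow the order of the four base triples; \<open>h\<close> is the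
    least component.\<close>
  have "y = x \<and> z = x \<or> y = x + 1 \<and> z = x + 1 \<or> x = y + 1 \<and> z = y + 1 \<or> x = z + 1 \<and> y = z + 1"
    using assms by presburger
  then show ?thesis by (auto simp: translate_def)
qed

theorem theorem2p3:
  fixes a b c :: int
  shows "\<exists>h::int.
      R_H (a, b, c) = shift (R_H (0, 0, 0)) h \<or>
      (R_H (a, b, c) = shift (R_H (0, 1, 1)) h \<and>
       shift (R_H (0, 1, 1)) h = shift (R_H (1, 0, 1)) h \<and>
       shift (R_H (1, 0, 1)) h = shift (R_H (1, 1, 0)) h)"
proof -
  \<comment> \<open>\<open>rot\<close> sends (0, 1, 1) to (1, 1, 0) and that to (1, 0, 1), so the
    three nonzero base triples share one range.\<close>
  have rotations: "R_H (1, 1, 0) = R_H (0, 1, 1)" "R_H (1, 0, 1) = R_H (0, 1, 1)"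
    using R_H_rot[of "(0, 1, 1)"] R_H_rot[of "(1, 1, 0)"] by (simp_all add: rot_def)
  obtain x y z where mem: "(x, y, z) \<in> T_H (a, b, c)"
    and "2 * x - y - z \<le> 1" "2 * y - z - x \<le> 1" "2 * z - x - y \<le> 1"
    using ex_reduced_mem_T_H by blast
  then obtain h t where t: "t \<in> {(0, 0, 0), (0, 1, 1), (1, 0, 1), (1, 1, 0)}"
    and "(x, y, z) = translate h t"
    using reduced_cases by blast
  then have "R_H (a, b, c) = shift (R_H t) h"
    using R_H_eq_if_mem_T_H[OF mem] by (simp add: R_H_translate)
  then show ?thesis using t rotations by auto
qed

end
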